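(* Let $n\ge1$, $f\in\mathcal S(\mathbb R^n)$, $0<\beta<1$ and $1\le p<n/\beta$. Then $$\int_{\mathbb R^n\times\mathbb R^n}\frac{|f(x)-f(y)|^p}{|x-y|^{n+p\beta}}\,dx\,dy\ \ge\ D_{p,\beta}\int_{\mathbb R^n}|x|^{-p\beta}|f(x)|^p\,dx,$$ $$D_{p,\beta}=\int_{\mathbb R^n}\big|1-|x|^{-\lambda}\big|^p\,|x-\eta|^{-n-p\beta}\,dx,$$ where $\lambda=(n-p\beta)/p$ and $\eta\in S^{n-1}$.
   Context: $\mathcal S(\mathbb R^n)$ is the Schwartz class and $S^{n-1}$ the unit sphere in $\mathbb R^n$; by rotation invariance $D_{p,\beta}$ does not depend on the choice of $\eta\in S^{n-1}$. *)

theory Defs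
  imports "HOL-Analysis.Analysis"
begin

text \<open>
  Iterated partial derivatives on \<open>real ^ 'n\<close>, indexed by the list of coordinate directions in
  which to differentiate. A multi-index corresponds to the lists in which each direction occurs
  the prescribed number of times; quantifying over all lists therefore covers all multi-indices.
\<close>

primrec iter_partial :: "'n list \<Rightarrow> (real ^ 'n::finite \<Rightarrow> complex) \<Rightarrow> real ^ 'n \<Rightarrow> complex" where
  "iter_partial [] f = f"
| "iter_partial (i # is) f = (\<lambda>x. frechet_derivative (iter_partial is f) (at x) (axis i 1))"

text \<open>
  The first conjunct is smoothness: since every iterated partial derivative is differentiable
  everywhere, all of them are continuous.
\<close>

definition schwartz :: "(real ^ 'n::finite \<Rightarrow> complex) set" where
  "schwartz = {f.
     (\<forall>is x. iter_partial is f differentiable (at x)) \<and>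
     (\<forall>(\<alpha> :: 'n \<Rightarrow> nat) is.
        bounded (range (\<lambda>x. (\<Prod>j\<in>UNIV. (x $ j) ^ \<alpha> j) *\<^sub>R iter_partial is f x)))}"

text \<open>
  Integrals of nonnegative functions are taken in \<open>[0, \<infinity>]\<close>. The conventions \<open>0 powr a = 0\<close> and
  \<open>x / 0 = 0\<close> affect the integrand only at the two points \<open>0\<close> and \<open>\<eta>\<close>.
\<close>

definition D_const :: "real \<Rightarrow> real \<Rightarrow> real ^ 'n::finite \<Rightarrow> ennreal" where
  "D_const p \<beta> \<eta> =
     (let n = real CARD('n); l = (n - p * \<beta>) / p in
      \<integral>\<^sup>+ x. ennreal (\<bar>1 - norm x powr (- l)\<bar> powr p * norm (x - \<eta>) powr (- n - p * \<beta>))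
        \<partial>(lborel :: (real ^ 'n) measure))"

end

theory Submission
  imports Defs
begin

text \<open>
  Write \<open>n\<close> for the dimension, \<open>l = (n - p * \<beta>) / p\<close> and \<open>b = - n - p * \<beta>\<close>. The function
  \<open>\<omega> x = norm x powr (- l)\<close> is a virtual ground state of the nonlocal energy: the inequality
  compares \<open>f\<close> with \<open>\<omega>\<close> pointwise, under the integral sign, and the constant is what is left
  over. On the region \<open>norm x < norm y\<close> put \<open>t = \<omega> y / \<omega> x = (norm x / norm y) powr l < 1\<close>.
  Convexity of \<open>u powr p\<close>, applied to
  \<open>norm (f x) \<le> (1 - t) * (norm (f x - f y) / (1 - t)) + t * (norm (f y) / t)\<close>, gives with
  \<open>G x = norm x powr (l * p) * norm (f x) powr p\<close>
    \[ |f(x)-f(y)|^p \;\ge\; (1-t)^{p-1}\,|x|^{-lp}\,\bigl(G(x) - t\,G(y)\bigr) \]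
  (\<open>hardy_ground_state_inequality\<close>); it is an equality for \<open>f = \<omega>\<close>.

  After multiplication by \<open>norm (x - y) powr b\<close>, both terms on the right have the form
  \<open>K x y * G\<close>, where \<open>K\<close> is invariant under rotations and homogeneous of degree \<open>- 2 * n\<close>
  because \<open>- l * p + b = - 2 * n\<close>. For such a kernel the integral over one variable is a
  constant multiple of the power \<open>- n\<close> of the norm of the other variable, and the constant is
  the same for both variables (\<open>similarity_kernel_transport\<close>). So both terms integrate
  to multiples of the same quantity
    \[ \int |x|^{-n} G(x)\,dx = \int |x|^{-p\beta} |f(x)|^p\,dx, \]
  and the factors \<open>(1 - t) powr (p - 1)\<close> and \<open>(1 - t) powr (p - 1) * t\<close> of the two kernels
  differ by \<open>(1 - t) powr p\<close>. The resulting constant is the part of the integral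
  \<open>D_const p \<beta> \<eta>\<close> over the exterior of the unit ball. The same transport principle shows that
  the interior contributes equally (\<open>D_const_eq_twice_exterior\<close>), while the region
  \<open>norm y < norm x\<close> doubles the left-hand side, by symmetry.

  The two terms may each have infinite integral because of the singularity at \<open>x = y\<close>. They
  are therefore subtracted on \<open>norm x < \<sigma> * norm y\<close> with \<open>\<sigma> < 1\<close>, where everything is
  finite (\<open>fractional_hardy_cutoff\<close>), and \<open>\<sigma>\<close> is sent to \<open>1\<close> by monotone convergence.
\<close>

section \<open>Similarities and Lebesgue measure\<close>

lemma nn_integral_lborel_affine:
  fixes f :: "'a::euclidean_space \<Rightarrow> ennreal" and t :: 'a
  assumes [measurable]: "f \<in> borel_measurable borel" and "c \<noteq> 0"
  shows "(\<integral>\<^sup>+ x. f x \<partial>lborel) = ennreal (\<bar>c\<bar> ^ DIM('a)) * (\<integral>\<^sup>+ x. f (t + c *\<^sub>R x) \<partial>lborel)"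
  by (subst lborel_affine[OF assms(2), of t])
     (simp add: nn_integral_density nn_integral_distr nn_integral_cmult)

lemma nn_integral_lborel_translate:
  fixes f :: "'a::euclidean_space \<Rightarrow> ennreal" and t :: 'a
  assumes [measurable]: "f \<in> borel_measurable borel"
  shows "(\<integral>\<^sup>+ x. f (t + x) \<partial>lborel) = (\<integral>\<^sup>+ x. f x \<partial>lborel)"
    and "(\<integral>\<^sup>+ x. f (t - x) \<partial>lborel) = (\<integral>\<^sup>+ x. f x \<partial>lborel)"
  using nn_integral_lborel_affine[OF assms, of 1 t] nn_integral_lborel_affine[OF assms, of "-1" t]
  by simp_all

text \<open>
  The argument for uniqueness of Haar measure: the product of the integrals of \<open>f\<close> and of
  \<open>g \<circ> T\<close> is turned, by translating each variable by the other and by reflecting, into the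
  product of the integrals of \<open>g\<close> and of \<open>f \<circ> T\<close>. Taking for \<open>g\<close> the indicator of the unit
  ball, which satisfies \<open>g \<circ> T = g\<close>, makes the factor cancel.
\<close>

lemma nn_integral_orthogonal_transformation:
  fixes T :: "'a::euclidean_space \<Rightarrow> 'a" and f :: "'a \<Rightarrow> ennreal"
  assumes T: "orthogonal_transformation T" and f [measurable]: "f \<in> borel_measurable borel"
  shows "(\<integral>\<^sup>+ x. f (T x) \<partial>lborel) = (\<integral>\<^sup>+ x. f x \<partial>lborel)"
proof -
  define g :: "'a \<Rightarrow> ennreal" where "g = indicator (ball 0 1)"
  have g [measurable]: "g \<in> borel_measurable borel"
    unfolding g_def by (rule borel_measurable_indicator) simp
  have lin: "linear T" and surj: "surj T"
    using T orthogonal_transformation_linear orthogonal_transformation_surj by blast+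
  have [measurable]: "T \<in> borel_measurable borel"
    using lin linear_continuous_on linear_conv_bounded_linear borel_measurable_continuous_onI by blast
  have gT: "g (T x) = g x" for x
    by (simp add: g_def indicator_def orthogonal_transformation_norm[OF T])
  have g_pos: "(\<integral>\<^sup>+ x. g x \<partial>lborel) \<noteq> 0" 
    unfolding g_def using content_ball_pos[of 1 "0::'a"] 
    by (auto simp: measure_def)
  have g_fin: "(\<integral>\<^sup>+ x. g x \<partial>lborel) \<noteq> \<infinity>"
    unfolding g_def using emeasure_lborel_ball_finite[of "0::'a" 1] by simp
  \<comment> \<open>Translate \<open>T y\<close> by \<open>x\<close>, then \<open>x\<close> by \<open>- T y\<close>, then reflect \<open>T y\<close> about \<open>x / 2\<close>.\<close>
  have "(\<integral>\<^sup>+ x. f x \<partial>lborel) * (\<integral>\<^sup>+ y. g y \<partial>lborel) = (\<integral>\<^sup>+ x. \<integral>\<^sup>+ y. f x * g (T y) \<partial>lborel \<partial>lborel)"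
    by (simp add: gT nn_integral_cmult nn_integral_multc)
  also have "\<dots> = (\<integral>\<^sup>+ x. \<integral>\<^sup>+ y. f x * g (x + T y) \<partial>lborel \<partial>lborel)"
  proof (rule nn_integral_cong)
    fix x
    obtain u where u: "T u = x"
      using surj by (metis surjD)
    have "(\<integral>\<^sup>+ y. f x * g (T y) \<partial>lborel) = (\<integral>\<^sup>+ y. f x * g (T (u + y)) \<partial>lborel)"
      by (rule nn_integral_lborel_translate(1)[symmetric]) measurable
    then show "(\<integral>\<^sup>+ y. f x * g (T y) \<partial>lborel) = (\<integral>\<^sup>+ y. f x * g (x + T y) \<partial>lborel)"
      by (simp add: u linear_add[OF lin])
  qed
  also have "\<dots> = (\<integral>\<^sup>+ y. \<integral>\<^sup>+ x. f x * g (x + T y) \<partial>lborel \<partial>lborel)"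
    by (rule lborel_pair.Fubini') measurable
  also have "\<dots> = (\<integral>\<^sup>+ y. \<integral>\<^sup>+ x. f (x - T y) * g x \<partial>lborel \<partial>lborel)"
  proof (rule nn_integral_cong)
    fix y
    have "(\<integral>\<^sup>+ x. f x * g (x + T y) \<partial>lborel)
        = (\<integral>\<^sup>+ x. f (- T y + x) * g ((- T y + x) + T y) \<partial>lborel)"
      by (rule nn_integral_lborel_translate(1)[symmetric]) measurable
    then show "(\<integral>\<^sup>+ x. f x * g (x + T y) \<partial>lborel) = (\<integral>\<^sup>+ x. f (x - T y) * g x \<partial>lborel)"
      by simp
  qed
  also have "\<dots> = (\<integral>\<^sup>+ x. \<integral>\<^sup>+ y. f (x - T y) * g x \<partial>lborel \<partial>lborel)"
    by (rule lborel_pair.Fubini') measurable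
  also have "\<dots> = (\<integral>\<^sup>+ x. \<integral>\<^sup>+ y. f (T y) * g x \<partial>lborel \<partial>lborel)"
  proof (rule nn_integral_cong)
    fix x
    obtain u where u: "T u = x"
      using surj by (metis surjD)
    have "(\<integral>\<^sup>+ y. f (T y) * g x \<partial>lborel) = (\<integral>\<^sup>+ y. f (T (u - y)) * g x \<partial>lborel)"
      by (rule nn_integral_lborel_translate(2)[symmetric]) measurable
    then show "(\<integral>\<^sup>+ y. f (x - T y) * g x \<partial>lborel) = (\<integral>\<^sup>+ y. f (T y) * g x \<partial>lborel)"
      by (simp add: u linear_diff[OF lin])
  qed
  also have "\<dots> = (\<integral>\<^sup>+ x. f (T x) \<partial>lborel) * (\<integral>\<^sup>+ y. g y \<partial>lborel)"
    by (simp add: nn_integral_cmult nn_integral_multc)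
  finally show ?thesis
    using g_pos g_fin by (auto simp: mult.commute[of _ "\<integral>\<^sup>+ y. g y \<partial>lborel"] ennreal_mult_cancel_left)
qed

section \<open>Kernels invariant under similarities\<close>

text \<open>
  The measure with density \<open>K\<close> on pairs of points is then invariant under the diagonal
  action of dilations and of orthogonal maps: the factor \<open>c powr (2 * CARD('n))\<close> is the Jacobian of the
  dilation by \<open>c\<close> on pairs.
\<close>

definition similarity_kernel :: "(real ^ 'n::finite \<Rightarrow> real ^ 'n \<Rightarrow> ennreal) \<Rightarrow> bool" where
  "similarity_kernel K \<longleftrightarrow>
     case_prod K \<in> borel_measurable (borel \<Otimes>\<^sub>M borel) \<and>
     (\<forall>c>0. \<forall>x y. ennreal (c powr (2 * CARD('n))) * K (c *\<^sub>R x) (c *\<^sub>R y) = K x y) \<and>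
     (\<forall>T. orthogonal_transformation T \<longrightarrow> (\<forall>x y. K (T x) (T y) = K x y))"

lemma similarity_kernel_flip:
  assumes "similarity_kernel K" shows "similarity_kernel (\<lambda>x y. K y x)"
proof -
  have [measurable]: "case_prod K \<in> borel_measurable (borel \<Otimes>\<^sub>M borel)"
    using assms by (simp add: similarity_kernel_def)
  have "case_prod (\<lambda>x y. K y x) \<in> borel_measurable (borel \<Otimes>\<^sub>M borel)"
    by measurable
  with assms show ?thesis
    by (auto simp: similarity_kernel_def)
qed

text \<open>
  A similarity takes \<open>\<eta>\<close> to \<open>x\<close>; of the factor \<open>norm x powr (- 2 * n)\<close> given by homogeneity,
  the substitution in the integral absorbs \<open>norm x powr n\<close>.
\<close>

lemma similarity_kernel_marginal:
  fixes K :: "real ^ 'n::finite \<Rightarrow> real ^ 'n \<Rightarrow> ennreal"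
  assumes K: "similarity_kernel K" and "norm \<eta> = 1" and "x \<noteq> 0"
  shows "(\<integral>\<^sup>+ y. K x y \<partial>lborel)
    = ennreal (norm x powr (- real CARD('n))) * (\<integral>\<^sup>+ y. K \<eta> y \<partial>lborel)"
proof -
  have [measurable]: "case_prod K \<in> borel_measurable (borel \<Otimes>\<^sub>M borel)"
    and hom: "\<And>c x y. c > 0 \<Longrightarrow> ennreal (c powr (2 * CARD('n))) * K (c *\<^sub>R x) (c *\<^sub>R y) = K x y"
    and orth: "\<And>T x y. orthogonal_transformation T \<Longrightarrow> K (T x) (T y) = K x y"
    using K by (auto simp: similarity_kernel_def)
  define c where "c = norm x"
  have c: "c > 0"
    using assms by (simp add: c_def)
  obtain T where T: "orthogonal_transformation T" "T \<eta> = x /\<^sub>R c"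
    using orthogonal_transformation_exists[of \<eta> "x /\<^sub>R c"] assms by (auto simp: c_def)
  have x: "x = c *\<^sub>R T \<eta>"
    using T c by simp
  have "(\<integral>\<^sup>+ y. K x y \<partial>lborel) = ennreal (c powr CARD('n)) * (\<integral>\<^sup>+ y. K x (c *\<^sub>R y) \<partial>lborel)"
    using c nn_integral_lborel_affine[of "K x" c 0] by (simp add: powr_realpow)
  also have "(\<integral>\<^sup>+ y. K x (c *\<^sub>R y) \<partial>lborel) = (\<integral>\<^sup>+ y. K x (c *\<^sub>R T y) \<partial>lborel)"
    by (rule nn_integral_orthogonal_transformation[OF T(1), symmetric]) measurable
  also have "\<dots> = (\<integral>\<^sup>+ y. ennreal (c powr (- 2 * CARD('n))) * K \<eta> y \<partial>lborel)"
  proof (rule nn_integral_cong)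
    fix y
    have "K \<eta> y = ennreal (c powr (2 * CARD('n))) * K x (c *\<^sub>R T y)"
      unfolding x using hom[OF c] orth[OF T(1)] by simp
    moreover have "ennreal (c powr (- 2 * CARD('n))) * ennreal (c powr (2 * CARD('n))) = 1"
      using c by (simp add: ennreal_mult'[symmetric] powr_add[symmetric])
    ultimately show "K x (c *\<^sub>R T y) = ennreal (c powr (- 2 * CARD('n))) * K \<eta> y"
      by (simp add: mult.assoc[symmetric])
  qed
  also have "\<dots> = ennreal (c powr (- 2 * CARD('n))) * (\<integral>\<^sup>+ y. K \<eta> y \<partial>lborel)"
    by (rule nn_integral_cmult) measurable
  also have "ennreal (c powr CARD('n)) * \<dots> = ennreal (c powr (- real CARD('n))) * (\<integral>\<^sup>+ y. K \<eta> y \<partial>lborel)"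
    using c by (simp add: mult.assoc[symmetric] ennreal_mult'[symmetric] powr_add[symmetric])
  finally show ?thesis
    by (simp add: c_def)
qed

lemma dyadic_annulus_partition:
  fixes x :: "'a::real_normed_vector"
  assumes "x \<noteq> 0"
  shows "(\<integral>\<^sup>+ k. indicator {y. \<lfloor>log 2 (norm y)\<rfloor> = k} x \<partial>count_space UNIV) = 1"
proof -
  have "(\<integral>\<^sup>+ k. indicator {y. \<lfloor>log 2 (norm y)\<rfloor> = k} x \<partial>count_space UNIV)
    = (\<integral>\<^sup>+ k. indicator {\<lfloor>log 2 (norm x)\<rfloor>} k \<partial>count_space UNIV)"
    by (intro nn_integral_cong) (auto simp: indicator_def)
  then show ?thesis
    by simp
qed

text \<open>
  A mass transport argument. Think of \<open>K x y\<close> as mass sent from \<open>x\<close> to \<open>y\<close>. Dilation by a power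
  of 2 shows that the mass sent from the annulus with index 0 to the one with index \<open>k\<close> equals the mass
  sent from the annulus with index \<open>- k\<close> to the one with index 0. Summed over \<open>k\<close>, the total mass
  leaving the annulus is the total mass entering it; by \<open>similarity_kernel_marginal\<close> these are
  the two sides of the claim, each multiplied by the same constant \<open>c\<close>, which is positive and finite.
  Inversion in the unit sphere would give the same identity, at the price of its Jacobian.
\<close>

lemma similarity_kernel_transport:
  fixes K :: "real ^ 'n::finite \<Rightarrow> real ^ 'n \<Rightarrow> ennreal"
  assumes K: "similarity_kernel K" and \<eta>: "norm \<eta> = 1"
  shows "(\<integral>\<^sup>+ y. K \<eta> y \<partial>lborel) = (\<integral>\<^sup>+ x. K x \<eta> \<partial>lborel)"
proof -
  have Km [measurable]: "case_prod K \<in> borel_measurable (borel \<Otimes>\<^sub>M borel)"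
    and hom: "\<And>c x y. c > 0 \<Longrightarrow> ennreal (c powr (2 * CARD('n))) * K (c *\<^sub>R x) (c *\<^sub>R y) = K x y"
    using K by (auto simp: similarity_kernel_def)
  define A :: "int \<Rightarrow> (real ^ 'n) set" where "A k = {x. x \<noteq> 0 \<and> \<lfloor>log 2 (norm x)\<rfloor> = k}" for k
  have [measurable]: "A k \<in> sets borel" for k
    unfolding A_def by measurable
  have A_sum: "(\<integral>\<^sup>+ k. indicator (A k) x \<partial>count_space UNIV) = 1" if "x \<noteq> 0" for x
    using dyadic_annulus_partition[OF that] that by (simp add: A_def indicator_def)
  have A_scale: "2 powr k *\<^sub>R x \<in> A j \<longleftrightarrow> x \<in> A (j - k)" for k j :: int and x
  proof (cases "x = 0")
    case False
    then have "log 2 (norm (2 powr k *\<^sub>R x)) = log 2 (norm x) + of_int k"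
      by (simp add: log_mult)
    with False show ?thesis
      by (auto simp: A_def)
  qed (auto simp: A_def)
  have nz: "AE x in lborel. x \<noteq> (0 :: real ^ 'n)"
    by (rule AE_lborel_singleton)
  define M where "M j k = (\<integral>\<^sup>+ x. \<integral>\<^sup>+ y. indicator (A j) x * (indicator (A k) y * K x y) \<partial>lborel \<partial>lborel)"
    for j k
  define c where "c = (\<integral>\<^sup>+ x. indicator (A 0) x * ennreal (norm x powr (- real CARD('n))) \<partial>lborel)"
  have M_shift: "M j k = M (j - i) (k - i)" for i j k
  proof -
    let ?c = "2 powr real_of_int i"
    let ?h = "\<lambda>x y. indicator (A j) x * (indicator (A k) y * K x y)"
    have "M j k = ennreal (?c ^ CARD('n)) * (\<integral>\<^sup>+ x. \<integral>\<^sup>+ y. ?h (?c *\<^sub>R x) y \<partial>lborel \<partial>lborel)"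
      unfolding M_def
      by (subst nn_integral_lborel_affine[where c="?c" and t=0]) (simp_all)
    also have "\<dots> = ennreal (?c ^ CARD('n)) * (\<integral>\<^sup>+ x. ennreal (?c ^ CARD('n)) *
        (\<integral>\<^sup>+ y. ?h (?c *\<^sub>R x) (?c *\<^sub>R y) \<partial>lborel) \<partial>lborel)"
      by (intro arg_cong2[where f="(*)"] refl nn_integral_cong)
         (subst nn_integral_lborel_affine[where c="?c" and t=0], simp_all)
    also have "\<dots> = (\<integral>\<^sup>+ x. \<integral>\<^sup>+ y. ennreal (?c ^ CARD('n)) * (ennreal (?c ^ CARD('n)) *
        ?h (?c *\<^sub>R x) (?c *\<^sub>R y)) \<partial>lborel \<partial>lborel)"
      by (simp add: nn_integral_cmult)
    also have "\<dots> = M (j - i) (k - i)"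
      unfolding M_def
    proof (intro nn_integral_cong)
      fix x y
      have "ennreal (?c ^ CARD('n)) * (ennreal (?c ^ CARD('n)) * K (?c *\<^sub>R x) (?c *\<^sub>R y))
        = ennreal (?c powr (2 * CARD('n))) * K (?c *\<^sub>R x) (?c *\<^sub>R y)"
        by (simp add: mult.assoc[symmetric] ennreal_mult'[symmetric] powr_realpow[symmetric]
            powr_add[symmetric])
      also have "\<dots> = K x y"
        by (rule hom) simp
      finally have *: "ennreal (?c ^ CARD('n)) * (ennreal (?c ^ CARD('n)) * K (?c *\<^sub>R x) (?c *\<^sub>R y)) = K x y" .
      show "ennreal (?c ^ CARD('n)) * (ennreal (?c ^ CARD('n)) * ?h (?c *\<^sub>R x) (?c *\<^sub>R y))
        = indicator (A (j - i)) x * (indicator (A (k - i)) y * K x y)"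
        by (subst *[symmetric]) (simp add: indicator_def A_scale)
    qed
    finally show ?thesis .
  qed
  have sum_right: "(\<integral>\<^sup>+ k. M 0 k \<partial>count_space UNIV) = c * (\<integral>\<^sup>+ y. K \<eta> y \<partial>lborel)"
  proof -
    have "(\<integral>\<^sup>+ k. M 0 k \<partial>count_space UNIV) = (\<integral>\<^sup>+ x. \<integral>\<^sup>+ y. \<integral>\<^sup>+ k.
        indicator (A 0) x * (indicator (A k) y * K x y) \<partial>count_space UNIV \<partial>lborel \<partial>lborel)"
      unfolding M_def by (simp add: nn_integral_count_space_nn_integral)
    also have "\<dots> = (\<integral>\<^sup>+ x. \<integral>\<^sup>+ y. indicator (A 0) x * K x y \<partial>lborel \<partial>lborel)"
    proof (rule nn_integral_cong, rule nn_integral_cong_AE)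
      fix x
      show "AE y in lborel. (\<integral>\<^sup>+ k. indicator (A 0) x * (indicator (A k) y * K x y) \<partial>count_space UNIV)
        = indicator (A 0) x * K x y"
        using nz by eventually_elim (simp add: nn_integral_cmult nn_integral_multc A_sum)
    qed
    also have "\<dots> = (\<integral>\<^sup>+ x. indicator (A 0) x * ennreal (norm x powr (- real CARD('n))) *
        (\<integral>\<^sup>+ y. K \<eta> y \<partial>lborel) \<partial>lborel)"
      using nz by (intro nn_integral_cong_AE, eventually_elim)
        (simp add: nn_integral_cmult similarity_kernel_marginal[OF K \<eta>] mult.assoc)
    also have "\<dots> = c * (\<integral>\<^sup>+ y. K \<eta> y \<partial>lborel)"
      unfolding c_def by (rule nn_integral_multc) measurable
    finally show ?thesis .
  qed
  have sum_left: "(\<integral>\<^sup>+ k. M k 0 \<partial>count_space UNIV) = c * (\<integral>\<^sup>+ x. K x \<eta> \<partial>lborel)"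
  proof -
    have "M k 0 = (\<integral>\<^sup>+ y. \<integral>\<^sup>+ x. indicator (A k) x * (indicator (A 0) y * K x y) \<partial>lborel \<partial>lborel)" for k
      unfolding M_def by (rule lborel_pair.Fubini') measurable
    then have "(\<integral>\<^sup>+ k. M k 0 \<partial>count_space UNIV) = (\<integral>\<^sup>+ y. \<integral>\<^sup>+ x. \<integral>\<^sup>+ k.
        indicator (A k) x * (indicator (A 0) y * K x y) \<partial>count_space UNIV \<partial>lborel \<partial>lborel)"
      by (simp add: nn_integral_count_space_nn_integral)
    also have "\<dots> = (\<integral>\<^sup>+ y. \<integral>\<^sup>+ x. indicator (A 0) y * K x y \<partial>lborel \<partial>lborel)"
    proof (rule nn_integral_cong, rule nn_integral_cong_AE)
      fix y
      show "AE x in lborel. (\<integral>\<^sup>+ k. indicator (A k) x * (indicator (A 0) y * K x y) \<partial>count_space UNIV)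
        = indicator (A 0) y * K x y"
        using nz by eventually_elim (simp add: nn_integral_multc A_sum)
    qed
    also have "\<dots> = (\<integral>\<^sup>+ y. indicator (A 0) y * ennreal (norm y powr (- real CARD('n))) *
        (\<integral>\<^sup>+ x. K x \<eta> \<partial>lborel) \<partial>lborel)"
      using nz by (intro nn_integral_cong_AE, eventually_elim)
        (simp add: nn_integral_cmult similarity_kernel_marginal[OF similarity_kernel_flip[OF K] \<eta>] mult.assoc)
    also have "\<dots> = c * (\<integral>\<^sup>+ x. K x \<eta> \<partial>lborel)"
      unfolding c_def by (rule nn_integral_multc) measurable
    finally show ?thesis .
  qed
  have "(\<integral>\<^sup>+ k. M 0 k \<partial>count_space UNIV) = (\<integral>\<^sup>+ k. M (uminus k) 0 \<partial>count_space UNIV)"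
    by (intro nn_integral_cong) (metis diff_0 diff_self M_shift)
  also have "\<dots> = (\<integral>\<^sup>+ k. M k 0 \<partial>count_space UNIV)"
    by (rule nn_integral_bij_count_space[where g=uminus and f="\<lambda>k. M k 0"]) (rule bij_uminus)
  finally have eq: "c * (\<integral>\<^sup>+ y. K \<eta> y \<partial>lborel) = c * (\<integral>\<^sup>+ x. K x \<eta> \<partial>lborel)"
    unfolding sum_left sum_right .
  have A_eq: "x \<in> A 0 \<longleftrightarrow> 1 \<le> norm x \<and> norm x < 2" for x
  proof (cases "x = 0")
    case False
    then have "0 < norm x"
      by simp
    with False show ?thesis
      unfolding A_def mem_Collect_eq floor_eq_iff by (simp add: le_log_iff log_less_iff)
  qed (simp add: A_def)
  have "c \<noteq> 0"
  proof
    assume "c = 0"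
    then have "AE x in lborel. indicator (A 0) x * ennreal (norm x powr (- real CARD('n))) = 0"
      unfolding c_def by (subst (asm) nn_integral_0_iff_AE) measurable
    then have "AE x in lborel. x \<notin> A 0"
      by eventually_elim (auto simp: A_eq indicator_def)
    \<comment> \<open>The annulus is \<open>1 \<le> norm x < 2\<close>; a ball of radius \<open>1 / 2\<close> about its middle fits into it.\<close>
    moreover have "ball ((3/2) *\<^sub>R \<eta>) (1/2) \<subseteq> A 0"
    proof
      fix x assume "x \<in> ball ((3/2) *\<^sub>R \<eta>) (1/2)"
      then have "norm (x - (3/2) *\<^sub>R \<eta>) < 1/2"
        by (simp add: dist_norm norm_minus_commute)
      moreover have "norm ((3/2) *\<^sub>R \<eta>) = 3/2"
        using \<eta> by simp
      ultimately show "x \<in> A 0"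
        using norm_triangle_ineq2[of x "(3/2) *\<^sub>R \<eta>"] norm_triangle_ineq3[of x "(3/2) *\<^sub>R \<eta>"]
        unfolding A_eq by linarith
    qed
    ultimately have "AE x in lborel. x \<notin> ball ((3/2) *\<^sub>R \<eta>) (1/2)"
      by (auto elim!: eventually_mono)
    then have "ball ((3/2) *\<^sub>R \<eta>) (1/2) \<in> null_sets lborel"
      by (subst AE_iff_null_sets) simp_all
    then show False
      using content_ball_pos[of "1/2" "(3/2) *\<^sub>R \<eta>"] by (auto simp: measure_def null_sets_def)
  qed
  moreover have "c \<noteq> \<infinity>"
  proof -
    have "c \<le> (\<integral>\<^sup>+ x. indicator (ball 0 2) x \<partial>(lborel :: (real ^ 'n) measure))"
      unfolding c_def
      by (intro nn_integral_mono)
         (auto simp: A_eq indicator_def powr_minus inverse_eq_divide divide_le_eq_1 ge_one_powr_ge_zero)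
    also have "\<dots> < \<infinity>"
      using emeasure_lborel_ball_finite by simp
    finally show ?thesis
      by simp
  qed
  ultimately show ?thesis
    using eq by (simp add: ennreal_mult_cancel_left)
qed

text \<open>
  It does not matter whether the weight \<open>g\<close> sits on the first or on the second variable: this is
  what makes the two sides of the ground state inequality comparable after integration.
\<close>

lemma nn_integral_similarity_kernel:
  fixes K :: "real ^ 'n::finite \<Rightarrow> real ^ 'n \<Rightarrow> ennreal"
  assumes K: "similarity_kernel K" and \<eta>: "norm \<eta> = 1" and [measurable]: "g \<in> borel_measurable borel"
  shows "(\<integral>\<^sup>+ x. \<integral>\<^sup>+ y. K x y * g x \<partial>lborel \<partial>lborel)
    = (\<integral>\<^sup>+ y. K \<eta> y \<partial>lborel) * (\<integral>\<^sup>+ x. ennreal (norm x powr (- real CARD('n))) * g x \<partial>lborel)"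
    and "(\<integral>\<^sup>+ x. \<integral>\<^sup>+ y. K x y * g y \<partial>lborel \<partial>lborel)
    = (\<integral>\<^sup>+ y. K \<eta> y \<partial>lborel) * (\<integral>\<^sup>+ x. ennreal (norm x powr (- real CARD('n))) * g x \<partial>lborel)"
proof -
  have *: "(\<integral>\<^sup>+ x. \<integral>\<^sup>+ y. K x y * g x \<partial>lborel \<partial>lborel)
    = (\<integral>\<^sup>+ y. K \<eta> y \<partial>lborel) * (\<integral>\<^sup>+ x. ennreal (norm x powr (- real CARD('n))) * g x \<partial>lborel)"
    if K: "similarity_kernel K" for K
  proof -
    have [measurable]: "case_prod K \<in> borel_measurable (borel \<Otimes>\<^sub>M borel)"
      using K by (auto simp: similarity_kernel_def)
    have nz: "AE x in lborel. x \<noteq> (0 :: real ^ 'n)"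
      by (rule AE_lborel_singleton)
    have "(\<integral>\<^sup>+ x. \<integral>\<^sup>+ y. K x y * g x \<partial>lborel \<partial>lborel)
      = (\<integral>\<^sup>+ x. (\<integral>\<^sup>+ y. K \<eta> y \<partial>lborel) * (ennreal (norm x powr (- real CARD('n))) * g x) \<partial>lborel)"
      using nz by (intro nn_integral_cong_AE, eventually_elim)
        (subst nn_integral_multc, measurable, simp add: similarity_kernel_marginal[OF K \<eta>] mult_ac)
    then show ?thesis
      by (simp add: nn_integral_cmult)
  qed
  show "(\<integral>\<^sup>+ x. \<integral>\<^sup>+ y. K x y * g x \<partial>lborel \<partial>lborel)
    = (\<integral>\<^sup>+ y. K \<eta> y \<partial>lborel) * (\<integral>\<^sup>+ x. ennreal (norm x powr (- real CARD('n))) * g x \<partial>lborel)"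
    by (rule *[OF K])
  have [measurable]: "case_prod K \<in> borel_measurable (borel \<Otimes>\<^sub>M borel)"
    using K by (auto simp: similarity_kernel_def)
  have "(\<integral>\<^sup>+ x. \<integral>\<^sup>+ y. K x y * g y \<partial>lborel \<partial>lborel) = (\<integral>\<^sup>+ y. \<integral>\<^sup>+ x. K x y * g y \<partial>lborel \<partial>lborel)"
    by (rule lborel_pair.Fubini') measurable
  then show "(\<integral>\<^sup>+ x. \<integral>\<^sup>+ y. K x y * g y \<partial>lborel \<partial>lborel)
    = (\<integral>\<^sup>+ y. K \<eta> y \<partial>lborel) * (\<integral>\<^sup>+ x. ennreal (norm x powr (- real CARD('n))) * g x \<partial>lborel)"
    using *[OF similarity_kernel_flip[OF K]] similarity_kernel_transport[OF K \<eta>] by simp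
qed

text \<open>
  The profile \<open>\<phi>\<close> depends only on the ratio of the norms, hence is invariant under similarities.
  For \<open>y = 0\<close> the ratio is \<open>0\<close>.
\<close>

definition power_kernel :: "(real \<Rightarrow> real) \<Rightarrow> real \<Rightarrow> real \<Rightarrow> real ^ 'n::finite \<Rightarrow> real ^ 'n \<Rightarrow> ennreal" where
  "power_kernel \<phi> a b x y = ennreal (\<phi> (norm x / norm y) * norm x powr a * norm (x - y) powr b)"

lemma borel_measurable_power_kernel [measurable (raw)]:
  assumes [measurable]: "\<phi> \<in> borel_measurable borel" "f \<in> borel_measurable M" "g \<in> borel_measurable M"
  shows "(\<lambda>x. power_kernel \<phi> a b (f x) (g x)) \<in> borel_measurable M"
  unfolding power_kernel_def by measurable

lemma similarity_power_kernel:
  assumes [measurable]: "\<phi> \<in> borel_measurable borel" and "a + b = - 2 * real CARD('n)"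
  shows "similarity_kernel (power_kernel \<phi> a b :: real ^ 'n::finite \<Rightarrow> real ^ 'n \<Rightarrow> ennreal)"
  unfolding similarity_kernel_def
proof (intro conjI allI impI)
  show "case_prod (power_kernel \<phi> a b :: real ^ 'n \<Rightarrow> real ^ 'n \<Rightarrow> ennreal) \<in> borel_measurable (borel \<Otimes>\<^sub>M borel)"
    by measurable
next
  fix c :: real and x y :: "real ^ 'n"
  assume c: "c > 0"
  have "norm (c *\<^sub>R x - c *\<^sub>R y) = c * norm (x - y)"
    using c by (simp add: scaleR_diff_right[symmetric])
  then have "\<phi> (norm (c *\<^sub>R x) / norm (c *\<^sub>R y)) * norm (c *\<^sub>R x) powr a * norm (c *\<^sub>R x - c *\<^sub>R y) powr b
    = (c powr a * c powr b) * (\<phi> (norm x / norm y) * norm x powr a * norm (x - y) powr b)"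
    using c by (simp add: powr_mult)
  also have "c powr a * c powr b = c powr (- 2 * real CARD('n))"
    using assms by (simp add: powr_add[symmetric])
  finally have "power_kernel \<phi> a b (c *\<^sub>R x) (c *\<^sub>R y)
    = ennreal (c powr (- 2 * real CARD('n)) * (\<phi> (norm x / norm y) * norm x powr a * norm (x - y) powr b))"
    by (simp only: power_kernel_def)
  moreover have "c powr (2 * CARD('n)) * (c powr (- 2 * real CARD('n)) * v) = v" for v
    using c by (simp add: mult.assoc[symmetric] powr_add[symmetric])
  ultimately show "ennreal (c powr (2 * CARD('n))) * power_kernel \<phi> a b (c *\<^sub>R x) (c *\<^sub>R y) = power_kernel \<phi> a b x y"
    by (simp only: power_kernel_def ennreal_mult'[OF powr_ge_zero, symmetric])
next
  fix T :: "real ^ 'n \<Rightarrow> real ^ 'n" and x y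
  assume T: "orthogonal_transformation T"
  then have "T x - T y = T (x - y)"
    using linear_diff orthogonal_transformation_linear by metis
  then show "power_kernel \<phi> a b (T x) (T y) = power_kernel \<phi> a b x y"
    by (simp add: power_kernel_def orthogonal_transformation_norm[OF T])
qed

section \<open>The pointwise inequality\<close>

lemma powr_convex_combination:
  fixes x y p t :: real
  assumes "1 \<le> p" "0 < t" "t < 1" "0 \<le> x" "0 \<le> y"
  shows "((1 - t) * x + t * y) powr p \<le> (1 - t) * x powr p + t * y powr p"
proof -
  have shrink: "u powr p \<le> u" if "0 < u" "u < 1" for u :: real
    using powr_mono'[of 1 p u] that assms by simp
  consider "x = 0" | "y = 0" | "0 < x" "0 < y"
    using assms by linarith
  then show ?thesis
  proof cases
    case 1
    then show ?thesis
      using assms shrink[of t] by (simp add: powr_mult mult_right_mono)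
  next
    case 2
    then show ?thesis
      using assms shrink[of "1 - t"] by (simp add: powr_mult mult_right_mono)
  next
    case 3
    then show ?thesis
      using convex_onD[OF powr_convex[OF assms(1)], of t x y] assms by simp
  qed
qed

text \<open>
  Convexity applied to \<open>norm a \<le> (1 - t) * (norm (a - b) / (1 - t)) + t * (norm b / t)\<close>; this
  splitting is sharp when \<open>b\<close> is \<open>t\<close> times \<open>a\<close>.
\<close>

lemma norm_diff_powr_lower_bound:
  fixes a b :: "'a::real_normed_vector" and p t :: real
  assumes "1 \<le> p" "0 < t" "t < 1"
  shows "(1 - t) powr (p - 1) * norm a powr p
    \<le> norm (a - b) powr p + (1 - t) powr (p - 1) * (t powr (1 - p) * norm b powr p)"
proof -
  have "norm a \<le> (1 - t) * (norm (a - b) / (1 - t)) + t * (norm b / t)"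
    using assms norm_triangle_ineq[of "a - b" b] by simp
  then have "norm a powr p \<le> ((1 - t) * (norm (a - b) / (1 - t)) + t * (norm b / t)) powr p"
    using assms by (intro powr_mono2) auto
  also have "\<dots> \<le> (1 - t) * (norm (a - b) / (1 - t)) powr p + t * (norm b / t) powr p"
    using assms by (intro powr_convex_combination) auto
  finally have "(1 - t) powr (p - 1) * norm a powr p
    \<le> (1 - t) powr (p - 1) * ((1 - t) * (norm (a - b) / (1 - t)) powr p + t * (norm b / t) powr p)"
    by (rule mult_left_mono) simp
  also have "\<dots> = norm (a - b) powr p + (1 - t) powr (p - 1) * (t powr (1 - p) * norm b powr p)"
  proof -
    have "(1 - t) powr (p - 1) * ((1 - t) * (norm (a - b) / (1 - t)) powr p) = norm (a - b) powr p"
      using assms by (simp add: powr_divide powr_diff)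
    moreover have "t * (norm b / t) powr p = t powr (1 - p) * norm b powr p"
      using assms by (simp add: powr_divide powr_diff)
    ultimately show ?thesis
      by (simp only: distrib_left)
  qed
  finally show ?thesis .
qed

text \<open>
  The choice of \<open>t\<close> is the ratio of the values at \<open>y\<close> and \<open>x\<close> of \<open>norm x powr (- l)\<close>. The weight \<open>G\<close> is the
  \<open>p\<close>-th power of \<open>norm (f x)\<close> measured in units of that function, so that it is constant, and the
  inequality sharp, when \<open>norm (f x) = norm x powr (- l)\<close> and \<open>f\<close> has constant direction.
\<close>

lemma hardy_ground_state_inequality:
  fixes f :: "'a::real_normed_vector \<Rightarrow> 'b::real_normed_vector" and p l :: real
  assumes "1 \<le> p" "0 < l" "x \<noteq> 0" "norm x < norm y"
  defines "t \<equiv> (norm x / norm y) powr l" and "G \<equiv> \<lambda>x. norm x powr (l * p) * norm (f x) powr p"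
  shows "(1 - t) powr (p - 1) * norm x powr (- l * p) * G x
    \<le> norm (f x - f y) powr p + (1 - t) powr (p - 1) * t * norm x powr (- l * p) * G y"
proof -
  have pos: "0 < norm x" "0 < norm y"
    using assms by (auto intro: le_less_trans)
  have t: "0 < t" "t < 1"
    using assms pos powr_less_mono2[of l "norm x / norm y" 1] by (auto simp: t_def)
  have "norm x powr (- l * p) * G x = norm (f x) powr p"
    using pos by (simp add: G_def mult.assoc[symmetric] powr_add[symmetric])
  moreover have "t * norm x powr (- l * p) * G y = t powr (1 - p) * norm (f y) powr p"
    using pos by (simp add: G_def t_def powr_divide powr_powr powr_diff powr_minus field_simps powr_mult_base powr_add)
  ultimately show ?thesis
    using norm_diff_powr_lower_bound[OF assms(1) t, of "f x" "f y"] by (simp only: mult.assoc)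
qed

section \<open>Integrability of powers and of Schwartz functions\<close>

lemma emeasure_ball_dilate:
  fixes r :: real
  assumes "0 < r"
  shows "emeasure lborel (ball (0 :: 'a::euclidean_space) r)
    = ennreal (r ^ DIM('a)) * emeasure lborel (ball (0 :: 'a) 1)"
proof -
  have "emeasure lborel (ball (0 :: 'a) r) = (\<integral>\<^sup>+ x. indicator (ball (0 :: 'a) r) x \<partial>lborel)"
    by simp
  also have "\<dots> = ennreal (\<bar>r\<bar> ^ DIM('a)) * (\<integral>\<^sup>+ x. indicator (ball (0 :: 'a) r) (0 + r *\<^sub>R x) \<partial>lborel)"
    using assms by (intro nn_integral_lborel_affine) (auto intro!: borel_measurable_indicator)
  also have "(\<lambda>x. indicator (ball (0 :: 'a) r) (0 + r *\<^sub>R x) :: ennreal) = indicator (ball 0 1)"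
    using assms by (auto simp: indicator_def fun_eq_iff)
  finally show ?thesis
    using assms by simp
qed

text \<open>
  On the dyadic shell with index \<open>k\<close> the volume grows like the power \<open>n\<close> of \<open>2 ^ k\<close>, so the integral
  is dominated by a geometric series with ratio \<open>2 powr (- \<epsilon>)\<close>.
\<close>

lemma nn_integral_norm_powr_exterior:
  fixes \<epsilon> :: real
  assumes "0 < \<epsilon>"
  shows "(\<integral>\<^sup>+ x. ennreal (norm x powr (- real DIM('a) - \<epsilon>)) * indicator {x. 1 \<le> norm x} x
      \<partial>(lborel :: 'a::euclidean_space measure)) < \<infinity>"
proof -
  let ?d = "real DIM('a)" and ?V = "emeasure lborel (ball (0 :: 'a) 1)"
  define B where "B k = ball (0 :: 'a) (2 ^ Suc k)" for k
  have [measurable]: "B k \<in> sets borel" for k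
    by (simp add: B_def)
  define q :: real where "q = 2 powr (- \<epsilon>)"
  have q: "0 < q" "q < 1"
    using assms by (auto simp: q_def powr_less_one)
  have "(\<integral>\<^sup>+ x. ennreal (norm x powr (- ?d - \<epsilon>)) * indicator {x. 1 \<le> norm x} x
      \<partial>(lborel :: 'a measure))
    \<le> (\<integral>\<^sup>+ x. (\<Sum>k. ennreal ((2 ^ k) powr (- ?d - \<epsilon>)) * indicator (B k) x) \<partial>lborel)"
  proof (rule nn_integral_mono)
    fix x :: 'a
    show "ennreal (norm x powr (- ?d - \<epsilon>)) * indicator {x. 1 \<le> norm x} x
      \<le> (\<Sum>k. ennreal ((2 ^ k) powr (- ?d - \<epsilon>)) * indicator (B k) x)"
    proof (cases "1 \<le> norm x")
      case True
      define h where "h j = ennreal ((2 ^ j) powr (- ?d - \<epsilon>)) * indicator (B j) x" for j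
      define k where "k = nat \<lfloor>log 2 (norm x)\<rfloor>"
      have pos: "0 < norm x"
        using True by linarith
      then have "0 \<le> log 2 (norm x)"
        using True by (subst zero_le_log_cancel_iff) auto
      then have "real k = of_int \<lfloor>log 2 (norm x)\<rfloor>"
        by (simp add: k_def)
      then have "real k \<le> log 2 (norm x)" "log 2 (norm x) < real (Suc k)"
        by linarith+
      then have "2 powr real k \<le> norm x" "norm x < 2 powr real (Suc k)"
        using pos by (simp_all only: le_log_iff log_less_iff one_less_numeral_iff semiring_norm)
      then have k: "2 ^ k \<le> norm x" "norm x < 2 ^ Suc k"
        by (simp_all only: powr_realpow zero_less_numeral)
      have "ennreal (norm x powr (- ?d - \<epsilon>)) * indicator {x. 1 \<le> norm x} x
        \<le> ennreal ((2 ^ k) powr (- ?d - \<epsilon>)) * indicator (B k) x"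
        using True k assms by (auto simp: B_def indicator_def intro!: ennreal_leI powr_mono2')
      also have "\<dots> = h k"
        by (simp add: h_def)
      also have "\<dots> \<le> (\<Sum>j. h j)"
        using sum_le_suminf[of h "{k}"] by simp
      finally show ?thesis
        by (simp add: h_def)
    qed simp
  qed
  also have "\<dots> = (\<Sum>k. ennreal ((2 ^ k) powr (- ?d - \<epsilon>)) * emeasure lborel (B k))"
    by (subst nn_integral_suminf) (auto simp: nn_integral_cmult_indicator)
  also have "\<dots> = (\<Sum>k. ennreal (q ^ k) * (ennreal (2 ^ DIM('a)) * ?V))"
  proof (rule suminf_cong)
    fix k
    have "(2 ^ k) powr (- ?d - \<epsilon>) * (2 ^ Suc k) ^ DIM('a) = q ^ k * 2 ^ DIM('a)"
      by (simp add: q_def powr_realpow[symmetric] powr_powr powr_add[symmetric] powr_mult algebra_simps)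
    then show "ennreal ((2 ^ k) powr (- ?d - \<epsilon>)) * emeasure lborel (B k)
      = ennreal (q ^ k) * (ennreal (2 ^ DIM('a)) * ?V)"
      unfolding B_def using q
      by (subst emeasure_ball_dilate)
         (simp_all add: mult.assoc[symmetric] ennreal_mult'[symmetric] del: power_Suc)
  qed
  also have "\<dots> = (\<Sum>k. ennreal (q ^ k)) * (ennreal (2 ^ DIM('a)) * ?V)"
    by (rule ennreal_suminf_multc)
  also have "(\<Sum>k. ennreal (q ^ k)) = ennreal (\<Sum>k. q ^ k)"
    using q by (intro suminf_ennreal2) (auto simp: summable_geometric)
  also have "\<dots> * (ennreal (2 ^ DIM('a)) * ?V) < \<infinity>"
    using emeasure_lborel_ball_finite[of "0::'a" 1] by (simp add: ennreal_mult_less_top)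
  finally show ?thesis .
qed

text \<open>
  The interior integral is the transpose of the exterior one: both are marginals of the kernel
  \<open>(norm x / norm y) powr (n + \<epsilon>) * norm x powr (- 2 * n)\<close> restricted to \<open>norm x < norm y\<close>.
\<close>

lemma nn_integral_norm_powr_interior:
  fixes \<epsilon> :: real
  assumes "0 < \<epsilon>"
  shows "(\<integral>\<^sup>+ x. ennreal (norm x powr (- real CARD('n) + \<epsilon>)) * indicator {x. norm x < 1} x
      \<partial>(lborel :: (real ^ 'n::finite) measure)) < \<infinity>"
proof -
  define \<phi> :: "real \<Rightarrow> real" where "\<phi> s = (if s < 1 then s powr (CARD('n) + \<epsilon>) else 0)" for s
  have [measurable]: "\<phi> \<in> borel_measurable borel"
    unfolding \<phi>_def by measurable
  define K where "K = (power_kernel \<phi> (- 2 * real CARD('n)) 0 :: real ^ 'n \<Rightarrow> real ^ 'n \<Rightarrow> ennreal)"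
  obtain \<eta> :: "real ^ 'n" where \<eta>: "norm \<eta> = 1"
    using vector_choose_size[of 1] by auto
  have "(\<integral>\<^sup>+ x. ennreal (norm x powr (- real CARD('n) + \<epsilon>)) * indicator {x. norm x < 1} x
      \<partial>(lborel :: (real ^ 'n) measure)) = (\<integral>\<^sup>+ x. K x \<eta> \<partial>lborel)"
    using \<eta> by (intro nn_integral_cong)
      (auto simp: K_def power_kernel_def \<phi>_def indicator_def powr_add[symmetric])
  also have "\<dots> = (\<integral>\<^sup>+ y. K \<eta> y \<partial>lborel)"
    unfolding K_def by (intro similarity_kernel_transport[symmetric] similarity_power_kernel \<eta>) simp_all
  also have "\<dots> \<le> (\<integral>\<^sup>+ y. ennreal (norm y powr (- real DIM(real ^ 'n) - \<epsilon>)) * indicator {y. 1 \<le> norm y} y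
      \<partial>(lborel :: (real ^ 'n) measure))"
  proof (rule nn_integral_mono)
    fix y :: "real ^ 'n"
    have "(1 / norm y) powr (CARD('n) + \<epsilon>) = norm y powr (- real CARD('n) - \<epsilon>)"
      by (simp add: powr_divide powr_minus_divide[symmetric])
    moreover have "1 \<le> norm y" if "1 / norm y < 1" "y \<noteq> 0"
      using that by (simp add: divide_less_eq)
    ultimately show "K \<eta> y \<le> ennreal (norm y powr (- real DIM(real ^ 'n) - \<epsilon>)) * indicator {y. 1 \<le> norm y} y"
      using \<eta> by (cases "y = 0") (auto simp: K_def power_kernel_def \<phi>_def indicator_def)
  qed
  also have "\<dots> < \<infinity>"
    by (rule nn_integral_norm_powr_exterior) fact
  finally show ?thesis .
qed

lemma schwartz_continuous:
  assumes "f \<in> schwartz"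
  shows "continuous_on UNIV f"
proof -
  have "iter_partial [] f differentiable (at x)" for x
    using assms unfolding schwartz_def by blast
  then have "f differentiable (at x)" for x
    by simp
  then show ?thesis
    by (intro continuous_at_imp_continuous_on ballI differentiable_imp_continuous_within)
qed

lemma schwartz_norm_power_bounded:
  fixes f :: "real ^ 'n::finite \<Rightarrow> complex"
  assumes "f \<in> schwartz"
  obtains C where "0 \<le> C" "\<And>x. norm x ^ m * norm (f x) \<le> C"
proof -
  have "\<exists>C. \<forall>x. \<bar>x $ j\<bar> ^ m * norm (f x) \<le> C" for j
  proof -
    have "bounded (range (\<lambda>x. (\<Prod>i\<in>UNIV. (x $ i) ^ (if i = j then m else 0)) *\<^sub>R iter_partial [] f x))"
    proof -
      have "\<forall>(\<alpha> :: 'n \<Rightarrow> nat) is. bounded (range (\<lambda>x. (\<Prod>j\<in>UNIV. (x $ j) ^ \<alpha> j) *\<^sub>R iter_partial is f x))"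
        using assms unfolding schwartz_def mem_Collect_eq by (rule conjunct2)
      then show ?thesis
        by (elim allE)
    qed
    moreover have "(\<Prod>i\<in>UNIV. (x $ i) ^ (if i = j then m else 0)) = (x $ j) ^ m" for x :: "real ^ 'n"
      using prod.delta[of UNIV j "\<lambda>i. (x $ i) ^ m"] by (simp add: if_distrib cong: if_cong)
    ultimately show ?thesis
      by (auto simp: bounded_iff power_abs)
  qed
  then obtain C where C: "\<And>j x. \<bar>x $ j\<bar> ^ m * norm (f x) \<le> C j"
    by metis
  have C0: "0 \<le> C j" for j
    using C[of 0 j] by (rule order_trans[rotated]) simp
  show thesis
  proof (rule that)
    show "0 \<le> real CARD('n) ^ m * sum C UNIV"
      using C0 by (simp add: sum_nonneg)
    fix x :: "real ^ 'n"
    obtain j where j: "\<And>i. \<bar>x $ i\<bar> \<le> \<bar>x $ j\<bar>"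
    proof -
      have "Max (range (\<lambda>i. \<bar>x $ i\<bar>)) \<in> range (\<lambda>i. \<bar>x $ i\<bar>)"
        by (rule Max_in) auto
      then obtain j where "Max (range (\<lambda>i. \<bar>x $ i\<bar>)) = \<bar>x $ j\<bar>"
        by (rule imageE)
      then have "\<bar>x $ i\<bar> \<le> \<bar>x $ j\<bar>" for i
        using Max_ge[of "range (\<lambda>i. \<bar>x $ i\<bar>)" "\<bar>x $ i\<bar>"] by simp
      then show ?thesis
        using that by blast
    qed
    have "norm x \<le> (\<Sum>i\<in>UNIV. \<bar>x $ i\<bar>)"
      by (rule norm_le_l1_cart)
    also have "\<dots> \<le> CARD('n) * \<bar>x $ j\<bar>"
      using sum_bounded_above[of UNIV "\<lambda>i. \<bar>x $ i\<bar>" "\<bar>x $ j\<bar>"] j by simp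
    finally have "norm x ^ m * norm (f x) \<le> (CARD('n) * \<bar>x $ j\<bar>) ^ m * norm (f x)"
      by (intro mult_right_mono power_mono) auto
    also have "\<dots> = real CARD('n) ^ m * (\<bar>x $ j\<bar> ^ m * norm (f x))"
      by (simp add: power_mult_distrib)
    also have "\<dots> \<le> real CARD('n) ^ m * sum C UNIV"
      using C[of x j] C0 member_le_sum[of j UNIV C] by (intro mult_left_mono) (auto intro: order_trans)
    finally show "norm x ^ m * norm (f x) \<le> real CARD('n) ^ m * sum C UNIV" .
  qed
qed

text \<open>
  Near the origin \<open>f\<close> is bounded and \<open>s < n\<close>. Far away, decay of order \<open>n\<close> suffices: as \<open>1 \<le> p\<close>,
  the integrand is then at most a multiple of \<open>norm x powr (- n - s)\<close>.
\<close>

lemma schwartz_weighted_integral_finite: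
  fixes f :: "real ^ 'n::finite \<Rightarrow> complex" and p s :: real
  assumes f: "f \<in> schwartz" and p: "1 \<le> p" and s: "0 < s" "s < real CARD('n)"
  shows "(\<integral>\<^sup>+ x. ennreal (norm x powr (- s) * norm (f x) powr p) \<partial>lborel) < \<infinity>"
proof -
  let ?d = "real CARD('n)"
  obtain C where C: "0 \<le> C" "\<And>x. norm (f x) \<le> C"
    using schwartz_norm_power_bounded[OF f, of 0] by auto
  obtain D where D: "0 \<le> D" "\<And>x. norm x ^ CARD('n) * norm (f x) \<le> D"
    using schwartz_norm_power_bounded[OF f] by blast
  have [measurable]: "f \<in> borel_measurable borel"
    by (rule borel_measurable_continuous_onI[OF schwartz_continuous[OF f]])
  let ?I = "\<lambda>x :: real ^ 'n. ennreal (norm x powr (- ?d + (?d - s))) * indicator {x. norm x < 1} x"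
  let ?E = "\<lambda>x :: real ^ 'n. ennreal (norm x powr (- real DIM(real ^ 'n) - s)) * indicator {x. 1 \<le> norm x} x"
  have "(\<integral>\<^sup>+ x. ennreal (norm x powr (- s) * norm (f x) powr p) \<partial>lborel)
    \<le> (\<integral>\<^sup>+ x. ennreal (C powr p) * ?I x + ennreal (D powr p) * ?E x \<partial>lborel)"
  proof (rule nn_integral_mono)
    fix x :: "real ^ 'n"
    show "ennreal (norm x powr (- s) * norm (f x) powr p)
      \<le> ennreal (C powr p) * ?I x + ennreal (D powr p) * ?E x"
    proof (cases "norm x < 1")
      case True
      have "norm (f x) powr p \<le> C powr p"
        using C p by (intro powr_mono2) auto
      then have "norm x powr (- s) * norm (f x) powr p \<le> C powr p * norm x powr (- s)"
        by (simp add: mult.commute[of _ "norm x powr (- s)"] mult_left_mono)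
      then show ?thesis
        using True by (simp add: ennreal_mult'[symmetric] ennreal_leI)
    next
      case False
      then have x: "1 \<le> norm x" "0 < norm x"
        by auto
      have "norm (f x) \<le> D * norm x powr (- ?d)"
        using D(2)[of x] x by (simp add: powr_minus powr_realpow field_simps)
      then have "norm (f x) powr p \<le> (D * norm x powr (- ?d)) powr p"
        using p by (intro powr_mono2) auto
      also have "\<dots> = D powr p * norm x powr (- ?d * p)"
        using D by (simp add: powr_mult powr_powr)
      also have "\<dots> \<le> D powr p * norm x powr (- ?d)"
        using x p by (intro mult_left_mono powr_mono) auto
      finally have "norm x powr (- s) * norm (f x) powr p \<le> norm x powr (- s) * (D powr p * norm x powr (- ?d))"
        by (rule mult_left_mono) simp
      also have "\<dots> = D powr p * norm x powr (- ?d - s)"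
        by (simp only: diff_conv_add_uminus powr_add mult_ac)
      finally show ?thesis
        using False by (simp add: ennreal_mult'[symmetric] ennreal_leI)
    qed
  qed
  also have "\<dots> = ennreal (C powr p) * (\<integral>\<^sup>+ x. ?I x \<partial>lborel) + ennreal (D powr p) * (\<integral>\<^sup>+ x. ?E x \<partial>lborel)"
    by (simp add: nn_integral_add nn_integral_cmult)
  also have "\<dots> < \<infinity>"
    using nn_integral_norm_powr_interior[of "?d - s", where 'n='n]
      nn_integral_norm_powr_exterior[of s, where 'a="real ^ 'n"] s
    by (simp add: ennreal_mult_less_top)
  finally show ?thesis .
qed

section \<open>The sharp inequality\<close>

text \<open>
  With the profiles \<open>\<phi>1 = \<phi>2 + \<phi>3\<close> the integrated ground state inequality reads
  \<open>A1 * N \<le> J + A2 * N\<close> with \<open>A1 = A2 + A3\<close>. Cancelling \<open>A2 * N\<close> needs it to be finite: the cutoff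
  \<open>\<sigma> < 1\<close> keeps \<open>y\<close> away from \<open>\<eta>\<close> in \<open>A2\<close>, and at infinity the kernel decays
  at least like \<open>norm y powr b\<close>.
\<close>

lemma fractional_hardy_cutoff:
  fixes f :: "real ^ 'n::finite \<Rightarrow> complex" and p \<beta> \<sigma> l :: real and \<eta> :: "real ^ 'n"
  assumes [measurable]: "f \<in> borel_measurable borel"
    and p: "1 \<le> p" and \<beta>: "0 < \<beta>" and lpos: "0 < l" and lp: "l * p = real CARD('n) - p * \<beta>"
    and \<sigma>: "0 < \<sigma>" "\<sigma> < 1" and \<eta>: "norm \<eta> = 1"
    and fin: "(\<integral>\<^sup>+ x. ennreal (norm x powr (- p * \<beta>) * norm (f x) powr p) \<partial>lborel) < \<infinity>"
  defines "b \<equiv> - real CARD('n) - p * \<beta>"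
  shows "(\<integral>\<^sup>+ y. power_kernel (\<lambda>s. if s < \<sigma> then (1 - s powr l) powr p else 0) (- l * p) b \<eta> y \<partial>lborel)
      * (\<integral>\<^sup>+ x. ennreal (norm x powr (- p * \<beta>) * norm (f x) powr p) \<partial>lborel)
    \<le> (\<integral>\<^sup>+ x. \<integral>\<^sup>+ y. indicator {(x, y). norm x < norm y} (x, y) *
          ennreal (norm (f x - f y) powr p * norm (x - y) powr b) \<partial>lborel \<partial>lborel)"
proof -
  have b_neg: "b \<le> 0"
  proof -
    have "0 \<le> p * \<beta>" "0 \<le> real CARD('n)"
      using p \<beta> by simp_all
    then show ?thesis
      unfolding b_def by linarith
  qed
  define \<phi>1 where "\<phi>1 s = (if s < \<sigma> then (1 - s powr l) powr (p - 1) else 0)" for s :: real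
  define \<phi>2 where "\<phi>2 s = (if s < \<sigma> then (1 - s powr l) powr (p - 1) * s powr l else 0)" for s :: real
  define \<phi>3 where "\<phi>3 s = (if s < \<sigma> then (1 - s powr l) powr p else 0)" for s :: real
  have [measurable]: "\<phi>1 \<in> borel_measurable borel" "\<phi>2 \<in> borel_measurable borel" "\<phi>3 \<in> borel_measurable borel"
    unfolding \<phi>1_def \<phi>2_def \<phi>3_def by measurable
  define K1 K2 K3 where "K1 = (power_kernel \<phi>1 (- l * p) b :: real ^ 'n \<Rightarrow> real ^ 'n \<Rightarrow> ennreal)"
    and "K2 = (power_kernel \<phi>2 (- l * p) b :: real ^ 'n \<Rightarrow> real ^ 'n \<Rightarrow> ennreal)"
    and "K3 = (power_kernel \<phi>3 (- l * p) b :: real ^ 'n \<Rightarrow> real ^ 'n \<Rightarrow> ennreal)"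
  note K_defs = K1_def K2_def K3_def
  have [measurable]: "case_prod K1 \<in> borel_measurable (borel \<Otimes>\<^sub>M borel)"
    "case_prod K2 \<in> borel_measurable (borel \<Otimes>\<^sub>M borel)" "case_prod K3 \<in> borel_measurable (borel \<Otimes>\<^sub>M borel)"
    unfolding K_defs by measurable
  have conf: "similarity_kernel K1" "similarity_kernel K2"
    unfolding K_defs by (auto intro!: similarity_power_kernel simp: lp b_def)
  define G where "G x = norm x powr (l * p) * norm (f x) powr p" for x
  have [measurable]: "G \<in> borel_measurable borel"
    unfolding G_def by measurable
  define N where "N = (\<integral>\<^sup>+ x. ennreal (norm x powr (- p * \<beta>) * norm (f x) powr p) \<partial>lborel)"
  define J where "J = (\<integral>\<^sup>+ x. \<integral>\<^sup>+ y. indicator {(x, y). norm x < norm y} (x, y) *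
          ennreal (norm (f x - f y) powr p * norm (x - y) powr b) \<partial>lborel \<partial>lborel)"
  have nz: "AE x in lborel. x \<noteq> (0 :: real ^ 'n)"
    by (rule AE_lborel_singleton)
  have GN: "(\<integral>\<^sup>+ x. ennreal (norm x powr (- real CARD('n))) * ennreal (G x) \<partial>lborel) = N"
    unfolding N_def
  proof (rule nn_integral_cong)
    fix x :: "real ^ 'n"
    have "norm x powr (- real CARD('n)) * norm x powr (l * p) = norm x powr (- p * \<beta>)"
      by (simp add: powr_add[symmetric] lp)
    then show "ennreal (norm x powr (- real CARD('n))) * ennreal (G x)
      = ennreal (norm x powr (- p * \<beta>) * norm (f x) powr p)"
      by (simp add: G_def ennreal_mult'[symmetric] mult.assoc[symmetric])
  qed
  define A1 A2 A3 where "A1 = (\<integral>\<^sup>+ y. K1 \<eta> y \<partial>lborel)" and "A2 = (\<integral>\<^sup>+ y. K2 \<eta> y \<partial>lborel)"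
    and "A3 = (\<integral>\<^sup>+ y. K3 \<eta> y \<partial>lborel)"
  have "A1 = (\<integral>\<^sup>+ y. K2 \<eta> y + K3 \<eta> y \<partial>lborel)"
    unfolding A1_def
  proof (rule nn_integral_cong)
    fix y :: "real ^ 'n"
    have "\<phi>1 s = \<phi>2 s + \<phi>3 s" if "0 \<le> s" for s
    proof (cases "s < \<sigma>")
      case True
      then have "s powr l < 1"
        using that \<sigma> lpos powr_less_mono2[of l s 1] by simp
      then have "(1 - s powr l) powr p = (1 - s powr l) powr (p - 1) * (1 - s powr l)"
        using powr_add[of "1 - s powr l" "p - 1" 1] by simp
      then show ?thesis
        by (simp add: \<phi>1_def \<phi>2_def \<phi>3_def algebra_simps)
    qed (simp add: \<phi>1_def \<phi>2_def \<phi>3_def)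
    moreover have "0 \<le> \<phi>2 s" "0 \<le> \<phi>3 s" for s
      by (simp_all add: \<phi>2_def \<phi>3_def)
    ultimately show "K1 \<eta> y = K2 \<eta> y + K3 \<eta> y"
      by (simp add: K_defs power_kernel_def ennreal_plus[symmetric] distrib_right del: ennreal_plus)
  qed
  then have A_split: "A1 = A2 + A3"
    by (simp add: A2_def A3_def nn_integral_add)
  have "A2 \<le> (\<integral>\<^sup>+ y. ennreal ((1 - \<sigma>) powr b) * (ennreal (norm y powr b) * indicator {y. 1 \<le> norm y} y) \<partial>(lborel :: (real ^ 'n) measure))"
    unfolding A2_def
  proof (rule nn_integral_mono)
    fix y :: "real ^ 'n"
    show "K2 \<eta> y \<le> ennreal ((1 - \<sigma>) powr b) * (ennreal (norm y powr b) * indicator {y. 1 \<le> norm y} y)"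
    proof (cases "y \<noteq> 0 \<and> 1 / norm y < \<sigma>")
      case True
      then have y: "0 < norm y" "1 < \<sigma> * norm y"
        by (auto simp: field_simps)
      moreover have "\<sigma> * norm y \<le> norm y"
        using \<sigma> by (simp add: mult_left_le_one_le)
      ultimately have y1: "1 \<le> norm y"
        by linarith
      \<comment> \<open>As \<open>1 < \<sigma> * norm y\<close>, the unit vector \<open>\<eta>\<close> is short compared with \<open>y\<close>.\<close>
      have "(1 - \<sigma>) * norm y \<le> norm (\<eta> - y)"
        using y \<eta> norm_triangle_ineq2[of y \<eta>] by (simp add: algebra_simps norm_minus_commute)
      then have "norm (\<eta> - y) powr b \<le> ((1 - \<sigma>) * norm y) powr b"
        using y \<sigma> p \<beta> by (intro powr_mono2') (auto simp: b_neg)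
      also have "\<dots> = (1 - \<sigma>) powr b * norm y powr b"
        using \<sigma> by (simp add: powr_mult)
      finally have *: "norm (\<eta> - y) powr b \<le> (1 - \<sigma>) powr b * norm y powr b" .
      have "(1 / norm y) powr l \<le> 1"
        using y1 lpos by (intro powr_le1) (auto simp: divide_le_eq_1)
      moreover from this have "(1 - (1 / norm y) powr l) powr (p - 1) \<le> 1"
        using p by (intro powr_le1) auto
      ultimately have "\<phi>2 (1 / norm y) \<le> 1"
        by (auto simp: \<phi>2_def intro: mult_le_one)
      with * have "\<phi>2 (1 / norm y) * norm (\<eta> - y) powr b \<le> 1 * ((1 - \<sigma>) powr b * norm y powr b)"
        by (intro mult_mono) auto
      then show ?thesis
        using y1 \<eta> by (simp add: K2_def power_kernel_def ennreal_mult'[symmetric] ennreal_leI)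
    qed (auto simp: K2_def power_kernel_def \<phi>2_def \<eta>)
  qed
  also have "\<dots> = ennreal ((1 - \<sigma>) powr b) * (\<integral>\<^sup>+ y. ennreal (norm y powr b) * indicator {y. 1 \<le> norm y} y \<partial>(lborel :: (real ^ 'n) measure))"
    by (rule nn_integral_cmult) measurable
  also have "\<dots> < \<infinity>"
    using nn_integral_norm_powr_exterior[of "p * \<beta>", where 'a="real ^ 'n"] p \<beta>
    by (simp add: b_def ennreal_mult_less_top)
  finally have A2_fin: "A2 < \<infinity>" .
  have "A1 * N = (\<integral>\<^sup>+ x. \<integral>\<^sup>+ y. K1 x y * ennreal (G x) \<partial>lborel \<partial>lborel)"
    using nn_integral_similarity_kernel(1)[OF conf(1) \<eta>, of "\<lambda>x. ennreal (G x)"] by (simp add: A1_def GN)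
  also have "\<dots> \<le> (\<integral>\<^sup>+ x. \<integral>\<^sup>+ y. indicator {(x, y). norm x < norm y} (x, y) *
      ennreal (norm (f x - f y) powr p * norm (x - y) powr b) + K2 x y * ennreal (G y) \<partial>lborel \<partial>lborel)"
  proof (intro nn_integral_mono_AE, use nz in eventually_elim, intro nn_integral_mono_AE, use nz in eventually_elim)
    fix x y :: "real ^ 'n"
    assume x: "x \<noteq> 0" and y: "y \<noteq> 0"
    show "K1 x y * ennreal (G x) \<le> indicator {(x, y). norm x < norm y} (x, y) *
      ennreal (norm (f x - f y) powr p * norm (x - y) powr b) + K2 x y * ennreal (G y)"
    proof (cases "norm x / norm y < \<sigma>")
      case True
      then have "norm x / norm y < 1"
        using \<sigma> by linarith
      then have lt: "norm x < norm y"
        using y by simp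
      let ?t = "(norm x / norm y) powr l"
      have "(1 - ?t) powr (p - 1) * norm x powr (- l * p) * norm (x - y) powr b * G x
        \<le> norm (f x - f y) powr p * norm (x - y) powr b
          + (1 - ?t) powr (p - 1) * ?t * norm x powr (- l * p) * norm (x - y) powr b * G y"
        using mult_right_mono[OF hardy_ground_state_inequality[OF p lpos x lt, of f], of "norm (x - y) powr b"]
        by (simp add: G_def algebra_simps)
      then show ?thesis
        using True lt 
        by (simp add: K_defs power_kernel_def \<phi>1_def \<phi>2_def ennreal_mult'[symmetric] ennreal_plus[symmetric]
            ennreal_leI G_def del: ennreal_plus)
    qed (simp add: K_defs power_kernel_def \<phi>1_def)
  qed
  also have "\<dots> = (\<integral>\<^sup>+ x. (\<integral>\<^sup>+ y. indicator {(x, y). norm x < norm y} (x, y) *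
      ennreal (norm (f x - f y) powr p * norm (x - y) powr b) \<partial>lborel)
      + (\<integral>\<^sup>+ y. K2 x y * ennreal (G y) \<partial>lborel) \<partial>lborel)"
    by (intro nn_integral_cong nn_integral_add) measurable
  also have "\<dots> = J + (\<integral>\<^sup>+ x. \<integral>\<^sup>+ y. K2 x y * ennreal (G y) \<partial>lborel \<partial>lborel)"
    unfolding J_def by (intro nn_integral_add) measurable
  also have "(\<integral>\<^sup>+ x. \<integral>\<^sup>+ y. K2 x y * ennreal (G y) \<partial>lborel \<partial>lborel) = A2 * N"
    using nn_integral_similarity_kernel(2)[OF conf(2) \<eta>, of "\<lambda>x. ennreal (G x)"] by (simp add: A2_def GN)
  finally have "A2 * N + A3 * N \<le> A2 * N + J"
    by (simp add: A_split distrib_right add.commute)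
  moreover have "A2 * N < \<infinity>"
    using A2_fin fin by (simp add: N_def ennreal_mult_less_top)
  ultimately have "A3 * N \<le> J"
    by (auto simp: ennreal_add_left_cancel_le)
  then show ?thesis
    unfolding A3_def N_def J_def K3_def \<phi>3_def[abs_def] .
qed

text \<open>
  The cutoffs start at \<open>1 / 2\<close>, so that all of them lie strictly between \<open>0\<close> and \<open>1\<close>.
\<close>

lemma nn_integral_cutoff_SUP:
  fixes K :: "'a \<Rightarrow> ennreal" and r :: "'a \<Rightarrow> real"
  assumes [measurable]: "K \<in> borel_measurable M" "r \<in> borel_measurable M"
  shows "(\<integral>\<^sup>+ x. indicator {x. r x < 1} x * K x \<partial>M)
    = (SUP k. \<integral>\<^sup>+ x. indicator {x. r x < 1 - 1 / real (k + 2)} x * K x \<partial>M)"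
proof -
  define h where "h k x = indicator {x. r x < 1 - 1 / real (k + 2)} x * K x" for k x
  have [measurable]: "h k \<in> borel_measurable M" for k
    unfolding h_def by measurable
  have inc: "incseq h"
  proof (intro incseq_SucI le_funI)
    fix k x
    have "1 - 1 / real (k + 2) \<le> 1 - 1 / real (Suc k + 2)"
      by (simp add: frac_le)
    then show "h k x \<le> h (Suc k) x"
      unfolding h_def by (auto simp: indicator_def)
  qed
  have "(SUP k. h k x) = indicator {x. r x < 1} x * K x" for x
  proof (rule antisym)
    show "(SUP k. h k x) \<le> indicator {x. r x < 1} x * K x"
    proof (rule SUP_least)
      fix k
      show "h k x \<le> indicator {x. r x < 1} x * K x"
      proof (cases "r x < 1 - 1 / real (k + 2)")
        case True
        also have "1 - 1 / real (k + 2) < 1"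
          by simp
        finally show ?thesis
          using True by (simp add: h_def)
      qed (simp add: h_def)
    qed
    show "indicator {x. r x < 1} x * K x \<le> (SUP k. h k x)"
    proof (cases "r x < 1")
      case True
      then obtain k where k: "inverse (real (Suc k)) < 1 - r x"
        using reals_Archimedean[of "1 - r x"] by auto
      have "1 / real (k + 2) \<le> inverse (real (Suc k))"
        by (simp add: inverse_eq_divide frac_le)
      with k have "r x < 1 - 1 / real (k + 2)"
        by linarith
      then have "indicator {x. r x < 1} x * K x \<le> h k x"
        using True by (simp add: h_def)
      then show ?thesis
        by (rule SUP_upper2[OF UNIV_I])
    qed simp
  qed
  then have "(\<integral>\<^sup>+ x. indicator {x. r x < 1} x * K x \<partial>M) = (\<integral>\<^sup>+ x. (SUP k. h k x) \<partial>M)"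
    by simp
  also have "\<dots> = (SUP k. \<integral>\<^sup>+ x. h k x \<partial>M)"
    using inc by (rule nn_integral_monotone_convergence_SUP) measurable
  finally show ?thesis
    by (simp add: h_def)
qed

text \<open>
  The integrand of \<open>D_const p \<beta> \<eta>\<close> at \<open>x\<close> is \<open>K \<eta> x\<close> outside the unit ball and \<open>K x \<eta>\<close> inside it,
  because \<open>norm x powr (- l) - 1 = norm x powr (- l) * (1 - norm x powr l)\<close>. So the two halves
  are the two marginals of the same kernel, which agree.
\<close>

lemma D_const_eq_twice_exterior:
  fixes \<eta> :: "real ^ 'n::finite"
  assumes p: "1 \<le> p" and lpos: "0 < l" and lp: "l * p = real CARD('n) - p * \<beta>" and \<eta>: "norm \<eta> = 1"
  shows "D_const p \<beta> \<eta> = 2 * (\<integral>\<^sup>+ y. power_kernel (\<lambda>s. if s < 1 then (1 - s powr l) powr p else 0)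
    (- l * p) (- real CARD('n) - p * \<beta>) \<eta> y \<partial>lborel)"
proof -
  let ?b = "- real CARD('n) - p * \<beta>"
  define K :: "real ^ 'n \<Rightarrow> real ^ 'n \<Rightarrow> ennreal"
    where "K = power_kernel (\<lambda>s. if s < 1 then (1 - s powr l) powr p else 0) (- l * p) ?b"
  have K: "similarity_kernel K"
    unfolding K_def by (intro similarity_power_kernel) (auto simp: lp)
  then have [measurable]: "case_prod K \<in> borel_measurable (borel \<Otimes>\<^sub>M borel)"
    by (simp add: similarity_kernel_def)
  have l: "(real CARD('n) - p * \<beta>) / p = l"
    using lp p by (simp add: field_simps)
  have nz: "AE x in lborel. x \<noteq> (0 :: real ^ 'n)"
    by (rule AE_lborel_singleton)
  have "D_const p \<beta> \<eta> = (\<integral>\<^sup>+ x. K \<eta> x + K x \<eta> \<partial>lborel)"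
    unfolding D_const_def Let_def l
  proof (intro nn_integral_cong_AE, use nz in eventually_elim)
    fix x :: "real ^ 'n"
    assume x: "x \<noteq> 0"
    consider "norm x < 1" | "norm x = 1" | "1 < norm x"
      by linarith
    then show "ennreal (\<bar>1 - norm x powr (- l)\<bar> powr p * norm (x - \<eta>) powr ?b) = K \<eta> x + K x \<eta>"
    proof cases
      case 1
      have "norm x powr l \<le> 1"
        using 1 lpos by (intro powr_le1) auto
      then have "1 - norm x powr (- l) = - ((1 - norm x powr l) * norm x powr (- l))" "0 \<le> 1 - norm x powr l"
        using x by (simp_all add: powr_minus field_simps)
      then have "\<bar>1 - norm x powr (- l)\<bar> powr p = (1 - norm x powr l) powr p * norm x powr (- l * p)"
        by (simp add: abs_mult powr_mult powr_powr)
      then show ?thesis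
        using 1 x \<eta> by (simp add: K_def power_kernel_def)
    next
      case 2
      then show ?thesis
        using \<eta> by (simp add: K_def power_kernel_def)
    next
      case 3
      have "(1 / norm x) powr l \<le> 1"
        using 3 lpos by (intro powr_le1) (auto simp: divide_le_eq_1)
      moreover have "(1 / norm x) powr l = norm x powr (- l)"
        by (simp add: powr_divide powr_minus_divide)
      moreover have "1 / norm x < 1"
        using 3 by (simp add: divide_less_eq_1)
      ultimately show ?thesis
        using 3 \<eta> by (simp add: K_def power_kernel_def norm_minus_commute)
    qed
  qed
  also have "\<dots> = (\<integral>\<^sup>+ y. K \<eta> y \<partial>lborel) + (\<integral>\<^sup>+ x. K x \<eta> \<partial>lborel)"
    by (rule nn_integral_add) measurable
  also have "\<dots> = 2 * (\<integral>\<^sup>+ y. K \<eta> y \<partial>lborel)"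
    using similarity_kernel_transport[OF K \<eta>] by (simp add: mult_2)
  finally show ?thesis
    by (simp add: K_def)
qed

theorem theorem9:
  fixes f :: "real ^ 'n::finite \<Rightarrow> complex" and p \<beta> :: real and \<eta> :: "real ^ 'n"
  assumes "f \<in> schwartz"
    and "0 < \<beta>" and "\<beta> < 1"
    and "1 \<le> p" and "p < real CARD('n) / \<beta>"
    and "\<eta> \<in> sphere 0 1"
  shows "(\<integral>\<^sup>+ (x, y). ennreal (norm (f x - f y) powr p / norm (x - y) powr (real CARD('n) + p * \<beta>))
            \<partial>(lborel \<Otimes>\<^sub>M lborel))
         \<ge> D_const p \<beta> \<eta> *
           (\<integral>\<^sup>+ x. ennreal (norm x powr (- p * \<beta>) * norm (f x) powr p) \<partial>lborel)"
proof -
  define l where "l = (real CARD('n) - p * \<beta>) / p"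
  let ?b = "- real CARD('n) - p * \<beta>"
  have p: "1 \<le> p" and \<eta>: "norm \<eta> = 1"
    using assms by auto
  have lt: "p * \<beta> < real CARD('n)"
    using assms by (simp add: field_simps)
  have lpos: "0 < l" and lp: "l * p = real CARD('n) - p * \<beta>"
    using lt p by (auto simp: l_def)
  have [measurable]: "f \<in> borel_measurable borel"
    by (rule borel_measurable_continuous_onI[OF schwartz_continuous[OF assms(1)]])
  define N where "N = (\<integral>\<^sup>+ x. ennreal (norm x powr (- p * \<beta>) * norm (f x) powr p) \<partial>lborel)"
  have fin: "(\<integral>\<^sup>+ x. ennreal (norm x powr (- p * \<beta>) * norm (f x) powr p) \<partial>lborel) < \<infinity>"
    using schwartz_weighted_integral_finite[OF assms(1) p, of "p * \<beta>"] assms lt by simp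
  define F where "F x y = ennreal (norm (f x - f y) powr p * norm (x - y) powr ?b)" for x y
  have [measurable]: "case_prod F \<in> borel_measurable (borel \<Otimes>\<^sub>M borel)"
    unfolding F_def by measurable
  have F_sym: "F x y = F y x" for x y
    by (simp add: F_def norm_minus_commute)
  let ?ind = "\<lambda>x y :: real ^ 'n. indicator {(x, y). norm x < norm y} (x, y) :: ennreal"
  define J where "J = (\<integral>\<^sup>+ x. \<integral>\<^sup>+ y. ?ind x y * F x y \<partial>lborel \<partial>lborel)"
  let ?\<phi> = "\<lambda>\<sigma> s. if s < \<sigma> then (1 - s powr l) powr p else 0"
  let ?A = "\<lambda>\<sigma>. \<integral>\<^sup>+ y. power_kernel (?\<phi> \<sigma>) (- l * p) ?b \<eta> y \<partial>lborel"
  have "?A 1 = (\<integral>\<^sup>+ y. indicator {y. norm \<eta> / norm y < 1} y *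
      power_kernel (\<lambda>s. (1 - s powr l) powr p) (- l * p) ?b \<eta> y \<partial>lborel)"
    by (intro nn_integral_cong) (simp add: power_kernel_def indicator_def)
  also have "\<dots> = (SUP k. \<integral>\<^sup>+ y. indicator {y. norm \<eta> / norm y < 1 - 1 / real (k + 2)} y *
      power_kernel (\<lambda>s. (1 - s powr l) powr p) (- l * p) ?b \<eta> y \<partial>lborel)"
    by (rule nn_integral_cutoff_SUP) measurable
  also have "\<dots> = (SUP k. ?A (1 - 1 / real (k + 2)))"
    by (intro SUP_cong refl nn_integral_cong) (simp add: power_kernel_def indicator_def)
  finally have A_SUP: "?A 1 = (SUP k. ?A (1 - 1 / real (k + 2)))" .
  have "?A 1 * N = (SUP k. ?A (1 - 1 / real (k + 2)) * N)"
    unfolding A_SUP by (rule SUP_mult_right_ennreal)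
  also have "\<dots> \<le> J"
    unfolding N_def J_def F_def
    by (intro SUP_least fractional_hardy_cutoff p assms(2) lpos lp \<eta> fin) auto
  finally have half: "?A 1 * N \<le> J" .
  have "D_const p \<beta> \<eta> * N = 2 * (?A 1 * N)"
    by (simp add: D_const_eq_twice_exterior[OF p lpos lp \<eta>] mult.assoc)
  also have "\<dots> \<le> J + J"
    using half by (simp add: mult_2 add_mono)
  also have "J + J = (\<integral>\<^sup>+ x. \<integral>\<^sup>+ y. ?ind x y * F x y \<partial>lborel \<partial>lborel)
      + (\<integral>\<^sup>+ x. \<integral>\<^sup>+ y. ?ind y x * F x y \<partial>lborel \<partial>lborel)"
  proof -
    have "(\<integral>\<^sup>+ x. \<integral>\<^sup>+ y. ?ind y x * F x y \<partial>lborel \<partial>lborel) = (\<integral>\<^sup>+ y. \<integral>\<^sup>+ x. ?ind y x * F x y \<partial>lborel \<partial>lborel)"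
      by (rule lborel_pair.Fubini') measurable
    then show ?thesis
      by (simp add: J_def F_sym)
  qed
  also have "\<dots> = (\<integral>\<^sup>+ x. \<integral>\<^sup>+ y. ?ind x y * F x y + ?ind y x * F x y \<partial>lborel \<partial>lborel)"
    by (simp add: nn_integral_add)
  also have "\<dots> \<le> (\<integral>\<^sup>+ x. \<integral>\<^sup>+ y. F x y \<partial>lborel \<partial>lborel)"
    by (intro nn_integral_mono) (auto simp: indicator_def)
  also have "\<dots> = (\<integral>\<^sup>+ (x, y). F x y \<partial>(lborel \<Otimes>\<^sub>M lborel))"
    using lborel.nn_integral_fst[of "case_prod F" lborel] by simp
  also have "(\<lambda>(x, y). F x y) = (\<lambda>(x, y). ennreal (norm (f x - f y) powr p / norm (x - y) powr (real CARD('n) + p * \<beta>)))"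
  proof -
    have "z powr ?b = 1 / z powr (real CARD('n) + p * \<beta>)" for z :: real
      using powr_minus_divide[of z "real CARD('n) + p * \<beta>"] by simp
    then show ?thesis
      by (simp add: F_def fun_eq_iff)
  qed
  finally show ?thesis
    by (simp add: N_def)
qed

end
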